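(* Let $(W,S)$ be a Coxeter system with $|S|<\infty$ and let $\varphi$ be a group automorphism of $W$ with $\varphi^2=\mathrm{id}$ and $\varphi(S)=S$. Let $G=\{\mathrm{id},\varphi\}$, $W^G$ the fixed point subgroup, and $(\widetilde W,\widetilde S)$, $\phi:\widetilde W\to W$ as in the context. Then the subposet of the Bruhat order $\mathrm{Br}(W)$ induced by $W^G$ is isomorphic to the Bruhat order $\mathrm{Br}(\widetilde W)$.
   Context: Bruhat order on a Coxeter group: $v\le w$ iff some reduced expression of $w$ contains a subexpression that is a reduced expression of $v$. For $J\subseteq S$ with $W_J=\langle J\rangle$ finite, $w_0(J)$ is the longest element of $W_J$. Let $\widetilde S=\{\widetilde s_J\mid J\subseteq S\text{ is a }G\text{-orbit and }W_J\text{ finite}\}$. By a known theorem (H\'ee, M\"uhlherr, Steinberg), with suitable Coxeter relations $\widetilde S$ generates a Coxeter system $(\widetilde W,\widetilde S)$ such that $\widetilde s_J\mapsto w_0(J)$ defines an injective group homomorphism $\phi:\widetilde W\to W$ with image $W^G$; in particular $W^G\cong\widetilde W$. *)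

theory Defs
  imports
    "HOL-Algebra.Generated_Groups"
    "HOL-Library.Extended_Nat"
    "HOL-Library.Sublist"
begin

definition word_prod :: "('a, 'x) monoid_scheme \<Rightarrow> 'a list \<Rightarrow> 'a" where
  "word_prod W ws = foldr (\<lambda>x y. x \<otimes>\<^bsub>W\<^esub> y) ws \<one>\<^bsub>W\<^esub>"

definition coxeter_matrix :: "'a set \<Rightarrow> ('a \<Rightarrow> 'a \<Rightarrow> enat) \<Rightarrow> bool" where
  "coxeter_matrix S m \<longleftrightarrow>
     (\<forall>s\<in>S. \<forall>t\<in>S. m s t = m t s \<and> m s t \<ge> 1 \<and> (m s t = 1 \<longleftrightarrow> s = t))"

text \<open>
  One application of a defining relation \<open>(s t) ^ m s t = 1\<close> inside a word over \<open>S\<close>; a pair with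
  \<open>m s t = \<infinity>\<close> contributes no relation.
\<close>

inductive coxeter_step :: "'a set \<Rightarrow> ('a \<Rightarrow> 'a \<Rightarrow> enat) \<Rightarrow> 'a list \<Rightarrow> 'a list \<Rightarrow> bool"
  for S :: "'a set" and m :: "'a \<Rightarrow> 'a \<Rightarrow> enat" where
  "\<lbrakk>us \<in> lists S; vs \<in> lists S; s \<in> S; t \<in> S; m s t = enat k\<rbrakk>
   \<Longrightarrow> coxeter_step S m (us @ concat (replicate k [s, t]) @ vs) (us @ vs)"

text \<open>
  \<open>W\<close> is the group with presentation \<open>\<langle>S | (s t) ^ m s t = 1\<rangle>\<close>: the set \<open>S\<close> generates \<open>W\<close>, and two
  words over \<open>S\<close> represent the same element of \<open>W\<close> iff the defining relations transform one into the
  other. Positive words suffice because \<open>m s s = 1\<close> makes every generator its own inverse, so that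
  the group and the monoid presented by these relations coincide.
\<close>

definition coxeter_system :: "('a, 'x) monoid_scheme \<Rightarrow> 'a set \<Rightarrow> bool" where
  "coxeter_system W S \<longleftrightarrow>
     group W \<and> S \<subseteq> carrier W \<and> generate W S = carrier W \<and>
     (\<exists>m. coxeter_matrix S m \<and>
        (\<forall>us\<in>lists S. \<forall>vs\<in>lists S.
           word_prod W us = word_prod W vs \<longleftrightarrow> equivclp (coxeter_step S m) us vs))"

definition cox_length :: "('a, 'x) monoid_scheme \<Rightarrow> 'a set \<Rightarrow> 'a \<Rightarrow> nat" where
  "cox_length W S w = (LEAST n. \<exists>ws\<in>lists S. length ws = n \<and> word_prod W ws = w)"

definition reduced_expr :: "('a, 'x) monoid_scheme \<Rightarrow> 'a set \<Rightarrow> 'a list \<Rightarrow> 'a \<Rightarrow> bool" where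
  "reduced_expr W S ws w \<longleftrightarrow>
     ws \<in> lists S \<and> word_prod W ws = w \<and> length ws = cox_length W S w"

definition bruhat_le :: "('a, 'x) monoid_scheme \<Rightarrow> 'a set \<Rightarrow> 'a \<Rightarrow> 'a \<Rightarrow> bool" where
  "bruhat_le W S v w \<longleftrightarrow>
     (\<exists>ws vs. reduced_expr W S ws w \<and> subseq vs ws \<and> reduced_expr W S vs v)"

text \<open>Meaningful for \<open>J \<subseteq> S\<close> with \<open>generate W J\<close> finite, where the longest element is unique.\<close>

definition longest_elt :: "('a, 'x) monoid_scheme \<Rightarrow> 'a set \<Rightarrow> 'a set \<Rightarrow> 'a" where
  "longest_elt W S J =
     (THE w. w \<in> generate W J \<and> (\<forall>v\<in>generate W J. cox_length W S v \<le> cox_length W S w))"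

text \<open>
  A group of automorphisms is given by the set \<open>G\<close> of its members; only their values on the carrier
  of \<open>W\<close> are relevant.
\<close>

definition fixed_points :: "('a, 'x) monoid_scheme \<Rightarrow> ('a \<Rightarrow> 'a) set \<Rightarrow> 'a set" where
  "fixed_points W G = {w \<in> carrier W. \<forall>g\<in>G. g w = w}"

definition orbits_on :: "('a \<Rightarrow> 'a) set \<Rightarrow> 'a set \<Rightarrow> 'a set set" where
  "orbits_on G S = {{g s | g. g \<in> G} | s. s \<in> S}"

definition finite_type_orbits ::
  "('a, 'x) monoid_scheme \<Rightarrow> 'a set \<Rightarrow> ('a \<Rightarrow> 'a) set \<Rightarrow> 'a set set" where
  "finite_type_orbits W S G = {J \<in> orbits_on G S. finite (generate W J)}"

definition order_isomorphic ::
  "'a set \<Rightarrow> ('a \<Rightarrow> 'a \<Rightarrow> bool) \<Rightarrow> 'b set \<Rightarrow> ('b \<Rightarrow> 'b \<Rightarrow> bool) \<Rightarrow> bool" where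
  "order_isomorphic A r B r' \<longleftrightarrow>
     (\<exists>f. bij_betw f A B \<and> (\<forall>x\<in>A. \<forall>y\<in>A. r x y \<longleftrightarrow> r' (f x) (f y)))"

end

theory Submission
  imports Defs
begin

text \<open>
  The parity with which a reflection occurs among the reflections of a word is invariant under the
  defining relations; this gives the strong exchange condition, the subword property of the Bruhat
  order and its lifting property. For a folding, an element \<open>\<phi> v\<close> has either all or none of the
  elements of an orbit \<open>J\<close> as left descents, and strong exchange in \<open>W\<close> yields that the former
  happens exactly when \<open>st J\<close> is a left descent of \<open>v\<close>. Hence lengths add up when reduced words of \<open>Wt\<close>
  are expanded by reduced words of the longest elements \<open>w\<^sub>0(J)\<close>, which shows that \<open>\<phi>\<close> is monotone;
  conversely \<open>\<phi> u \<le> \<phi> v\<close> implies \<open>u \<le> v\<close> by stripping off one block \<open>w\<^sub>0(J)\<close> after the other with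
  the lifting property.
\<close>

section \<open>Reflections and the exchange condition\<close>

lemma subseq_lists: "subseq vs ws \<Longrightarrow> ws \<in> lists A \<Longrightarrow> vs \<in> lists A"
  by (induction rule: list_emb.induct) auto

locale coxeter = group W for W :: "('a, 'x) monoid_scheme" (structure) +
  fixes S :: "'a set"
  assumes coxeter_system: "coxeter_system W S"
begin

declare in_lists_conv_set [simp]

abbreviation wp :: "'a list \<Rightarrow> 'a" where
  "wp \<equiv> word_prod W"

abbreviation len :: "'a \<Rightarrow> nat" where
  "len \<equiv> cox_length W S"

section \<open>Conjugation in the group\<close>

definition conj_by :: "'a \<Rightarrow> 'a \<Rightarrow> 'a" where
  "conj_by u x = u \<otimes> x \<otimes> inv u"

lemma conj_closed [simp]: "u \<in> carrier W \<Longrightarrow> x \<in> carrier W \<Longrightarrow> conj_by u x \<in> carrier W"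
  by (simp add: conj_by_def)

lemma conj_one [simp]: "x \<in> carrier W \<Longrightarrow> conj_by \<one> x = x"
  by (simp add: conj_by_def)

lemma conj_mult:
  "u \<in> carrier W \<Longrightarrow> v \<in> carrier W \<Longrightarrow> x \<in> carrier W \<Longrightarrow> conj_by (u \<otimes> v) x = conj_by u (conj_by v x)"
  by (simp add: conj_by_def m_assoc inv_mult_group)

lemma conj_inv_cancel [simp]:
  "u \<in> carrier W \<Longrightarrow> x \<in> carrier W \<Longrightarrow> conj_by (inv u) (conj_by u x) = x"
  "u \<in> carrier W \<Longrightarrow> x \<in> carrier W \<Longrightarrow> conj_by u (conj_by (inv u) x) = x"
  by (simp_all flip: conj_mult)

lemma conj_eq_iff:
  "u \<in> carrier W \<Longrightarrow> x \<in> carrier W \<Longrightarrow> y \<in> carrier W \<Longrightarrow> conj_by u x = y \<longleftrightarrow> x = conj_by (inv u) y"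
  by auto

lemma conj_conj_mult:
  "u \<in> carrier W \<Longrightarrow> x \<in> carrier W \<Longrightarrow> conj_by u x \<otimes> u = u \<otimes> x"
  by (simp add: conj_by_def m_assoc)

lemma conj_self [simp]: "u \<in> carrier W \<Longrightarrow> conj_by u u = u"
  by (simp add: conj_by_def m_assoc)

lemma conj_hom:
  "u \<in> carrier W \<Longrightarrow> x \<in> carrier W \<Longrightarrow> y \<in> carrier W \<Longrightarrow> conj_by u (x \<otimes> y) = conj_by u x \<otimes> conj_by u y"
  using m_assoc[of "inv u" u "y \<otimes> inv u"] by (simp add: conj_by_def m_assoc)

section \<open>Words in the generators and their products\<close>

lemma wp_Nil [simp]: "wp [] = \<one>"
  by (simp add: word_prod_def)

lemma wp_Cons [simp]: "wp (s # ws) = s \<otimes> wp ws"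
  by (simp add: word_prod_def)

lemma S_carrier: "S \<subseteq> carrier W"
  using coxeter_system by (simp add: coxeter_system_def)

lemma S_closed [simp]: "s \<in> S \<Longrightarrow> s \<in> carrier W"
  using S_carrier by blast

lemma wp_closed [simp]: "ws \<in> lists S \<Longrightarrow> wp ws \<in> carrier W"
  by (induction ws) auto

lemma wp_append: "us \<in> lists S \<Longrightarrow> vs \<in> lists S \<Longrightarrow> wp (us @ vs) = wp us \<otimes> wp vs"
  by (induction us) (auto simp: m_assoc)

lemma presentation:
  "\<exists>m. coxeter_matrix S m \<and> (\<forall>us\<in>lists S. \<forall>vs\<in>lists S.
       wp us = wp vs \<longleftrightarrow> equivclp (coxeter_step S m) us vs)"
  using coxeter_system unfolding coxeter_system_def by (elim conjE)

lemma gen_square [simp]: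
  assumes "s \<in> S"
  shows "s \<otimes> s = \<one>"
proof -
  obtain m where m: "coxeter_matrix S m" "\<forall>us\<in>lists S. \<forall>vs\<in>lists S.
       wp us = wp vs \<longleftrightarrow> equivclp (coxeter_step S m) us vs"
    using presentation by (elim exE conjE)
  \<comment> \<open>The diagonal entry of the Coxeter matrix is itself a relation, applied here to
    the word \<open>[s, s]\<close> with \<open>k = 1\<close>.\<close>
  have "m s s = enat 1"
    using m(1) assms by (simp add: coxeter_matrix_def one_enat_def)
  from coxeter_step.intros[of "[]" S "[]" s s m, OF _ _ assms assms this]
  have "coxeter_step S m [s, s] []" by simp
  then have "wp [s, s] = wp []"
    using m(2)[rule_format, of "[s, s]" "[]"] assms by (simp add: r_into_equivclp)
  then show ?thesis using assms by simp
qed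

lemma gen_inv [simp]: "s \<in> S \<Longrightarrow> inv s = s"
  by (simp add: inv_equality)

lemma gen_cancel [simp]: "s \<in> S \<Longrightarrow> x \<in> carrier W \<Longrightarrow> s \<otimes> (s \<otimes> x) = x"
  by (simp flip: m_assoc)

lemma gen_conj_conj [simp]: "s \<in> S \<Longrightarrow> x \<in> carrier W \<Longrightarrow> conj_by s (conj_by s x) = x"
  using conj_inv_cancel(1)[of s x] by simp

lemma conj_square:
  "u \<in> carrier W \<Longrightarrow> s \<in> S \<Longrightarrow> conj_by u s \<otimes> conj_by u s = \<one>"
  by (simp flip: conj_hom) (simp add: conj_by_def)

lemma wp_rev: "ws \<in> lists S \<Longrightarrow> wp (rev ws) = inv (wp ws)"
  by (induction ws) (auto simp: wp_append inv_mult_group)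

text \<open>Generators are involutions, so the inverse of a letter is again a letter and positive
  words over \<open>J\<close> exhaust the subgroup.\<close>

lemma generate_words:
  assumes "J \<subseteq> S"
  shows "generate W J = wp ` lists J"
proof (intro equalityI subsetI)
  fix x assume "x \<in> generate W J"
  then show "x \<in> wp ` lists J"
  proof (induction rule: generate.induct)
    case one
    then show ?case by (auto intro: image_eqI[of _ _ "[]"])
  next
    case (incl h)
    then show ?case using assms by (auto intro!: image_eqI[of _ _ "[h]"] simp: subsetD)
  next
    case (inv h)
    then show ?case using assms by (auto intro!: image_eqI[of _ _ "[h]"] simp: subsetD)
  next
    case (eng x y)
    then obtain us vs where "us \<in> lists J" "x = wp us" "vs \<in> lists J" "y = wp vs" by blast
    moreover have "us \<in> lists S" "vs \<in> lists S"
      using calculation assms lists_mono[of J S] by blast+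
    ultimately show ?case by (intro image_eqI[of _ _ "us @ vs"]) (auto simp: wp_append)
  qed
next
  have "wp ws \<in> generate W J" if "ws \<in> lists J" for ws
    using that by (induction ws) (auto intro: generate.intros)
  then show "x \<in> generate W J" if "x \<in> wp ` lists J" for x
    using that by blast
qed

lemma ex_word:
  assumes "x \<in> carrier W"
  obtains ws where "ws \<in> lists S" "wp ws = x"
proof -
  have "generate W S = carrier W"
    using coxeter_system unfolding coxeter_system_def by (elim conjE)
  then have "x \<in> wp ` lists S" using assms generate_words[of S] by simp
  then show thesis using that by blast
qed

text \<open>For a word \<open>s1 ... sn\<close> the i-th entry is the reflection
  \<open>s1 ... s(i-1) si s(i-1) ... s1\<close>. Multiplying the product of the word by it from the
  left deletes the i-th letter.\<close>

primrec refls :: "'a list \<Rightarrow> 'a list" where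
  "refls [] = []"
| "refls (s # ws) = s # map (conj_by s) (refls ws)"

lemma refls_closed: "ws \<in> lists S \<Longrightarrow> set (refls ws) \<subseteq> carrier W"
  by (induction ws) auto

lemma refls_append:
  "us \<in> lists S \<Longrightarrow> vs \<in> lists S \<Longrightarrow> refls (us @ vs) = refls us @ map (conj_by (wp us)) (refls vs)"
proof (induction us)
  case Nil
  then show ?case using refls_closed[of vs] by (auto intro!: map_idI[symmetric])
next
  case (Cons s us)
  then show ?case using refls_closed[of vs] by (auto simp: conj_mult subset_iff)
qed

lemma count_map_conj:
  assumes "u \<in> carrier W" "t \<in> carrier W" "set xs \<subseteq> carrier W"
  shows "count_list (map (conj_by u) xs) t = count_list xs (conj_by (inv u) t)"
  using assms(3) by (induction xs) (use assms(1,2) in \<open>auto simp: conj_eq_iff\<close>)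

lemma count_refls_append:
  assumes "us \<in> lists S" "vs \<in> lists S" "t \<in> carrier W"
  shows "count_list (refls (us @ vs)) t =
    count_list (refls us) t + count_list (refls vs) (conj_by (inv (wp us)) t)"
  using assms by (simp add: refls_append count_map_conj refls_closed)

text \<open>Conjugation by \<open>s t\<close> raises the exponent in \<open>(s t)^i s\<close> by
  two, so prepending one more pair \<open>s, t\<close> shifts the old list by two places and adds
  the entries for \<open>i = 0, 1\<close> in front.\<close>

lemma refls_alternating:
  assumes "s \<in> S" "t \<in> S"
  shows "refls (concat (replicate n [s, t])) = map (\<lambda>i. (s \<otimes> t) [^] i \<otimes> s) [0..<2 * n]"
proof (induction n)
  case (Suc n)
  let ?g = "\<lambda>i::nat. (s \<otimes> t) [^] i \<otimes> s"
  have *: "conj_by s (conj_by t (?g i)) = ?g (Suc (Suc i))" for i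
  proof -
    have "conj_by s (conj_by t (?g i)) = conj_by (s \<otimes> t) (?g i)"
      using assms by (simp add: conj_mult)
    also have "\<dots> = (s \<otimes> t) \<otimes> (s \<otimes> t) [^] i \<otimes> (s \<otimes> t) \<otimes> s"
      using assms by (simp add: conj_by_def m_assoc inv_mult_group)
    also have "\<dots> = ?g (Suc (Suc i))"
      using assms by (simp add: nat_pow_Suc2[symmetric])
    finally show ?thesis .
  qed
  have "[0..<2 * Suc n] = 0 # 1 # map (\<lambda>i. Suc (Suc i)) [0..<2 * n]"
    using upt_add_eq_append[of 0 2 "2 * n"] map_add_upt[of 2 "2 * n"]
    by (simp add: add.commute numeral_2_eq_2 del: upt_Suc) simp
  then show ?case
    using assms Suc.IH by (simp add: * m_assoc conj_by_def[of s t])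
qed simp

text \<open>Since \<open>(s t)^k = 1\<close>, the entries \<open>(s t)^i s\<close> have period
  \<open>k\<close> in \<open>i\<close>. The second half of the list of length \<open>2 * k\<close>
  repeats the first, so every count is doubled.\<close>

lemma even_count_relator:
  assumes "s \<in> S" "t \<in> S" "wp (concat (replicate k [s, t])) = \<one>"
  shows "even (count_list (refls (concat (replicate k [s, t]))) r)"
proof -
  let ?g = "\<lambda>i::nat. (s \<otimes> t) [^] i \<otimes> s"
  have "wp (concat (replicate n [s, t])) = (s \<otimes> t) [^] n" for n
  proof (induction n)
    case (Suc n)
    then show ?case using assms(1,2) nat_pow_Suc2[of "s \<otimes> t" n] by (simp add: m_assoc)
  qed simp
  then have "(s \<otimes> t) [^] k = \<one>" using assms(3) by simp
  then have "?g (i + k) = ?g i" for i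
    using assms(1,2) by (simp flip: nat_pow_mult)
  moreover have "[k..<k + k] = map (\<lambda>i. i + k) [0..<k]"
    by (simp add: map_add_upt)
  ultimately have "map ?g [k..<2 * k] = map ?g [0..<k]"
    by (simp add: mult_2)
  moreover have "[0..<2 * k] = [0..<k] @ [k..<2 * k]"
    using upt_add_eq_append[of 0 k k] by (simp add: mult_2)
  ultimately show ?thesis
    using assms(1,2) by (simp add: refls_alternating)
qed

text \<open>Inserting a relator changes neither the product of the prefix nor, therefore, the
  conjugation applied to the reflections of the suffix; the relator itself contributes an even
  count.\<close>

lemma parity_wp:
  assumes "us \<in> lists S" "vs \<in> lists S" "wp us = wp vs" "r \<in> carrier W"
  shows "even (count_list (refls us) r) = even (count_list (refls vs) r)"
proof -
  obtain m where m: "coxeter_matrix S m" "\<forall>us\<in>lists S. \<forall>vs\<in>lists S.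
       wp us = wp vs \<longleftrightarrow> equivclp (coxeter_step S m) us vs"
    using presentation by (elim exE conjE)
  have step: "even (count_list (refls xs) r) = even (count_list (refls ys) r)"
    if "coxeter_step S m xs ys" for xs ys
    using that
  proof cases
    case (1 as bs s t k)
    let ?R = "concat (replicate k [s, t])"
    have R: "?R \<in> lists S" using 1 by auto
    have "coxeter_step S m ?R []"
      using coxeter_step.intros[of "[]" S "[]" s t m k] 1 by simp
    then have wR: "wp ?R = \<one>"
      using m(2)[rule_format, of ?R "[]"] R by (simp add: r_into_equivclp)
    show ?thesis
      using 1 R assms(4) even_count_relator[OF \<open>s \<in> S\<close> \<open>t \<in> S\<close> wR]
      by (simp add: count_refls_append wR)
  qed
  have "equivclp (coxeter_step S m) us vs" using m(2) assms(1-3) by blast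
  then show ?thesis
    by (induction rule: equivclp_induct) (use step in blast)+
qed

text \<open>This is the deletion of the letter to which the reflection \<open>t\<close> belongs; the
  conjugating prefix cancels. The word may be non-reduced.\<close>

lemma refls_delete:
  assumes "ws \<in> lists S" "t \<in> set (refls ws)"
  obtains vs where "subseq vs ws" "Suc (length vs) = length ws" "wp vs = t \<otimes> wp ws"
proof -
  have "\<exists>vs. subseq vs ws \<and> Suc (length vs) = length ws \<and> wp vs = t \<otimes> wp ws"
    using assms
  proof (induction ws arbitrary: t rule: list.induct)
    case (Cons s ws)
    have l: "s \<in> S" "ws \<in> lists S" using Cons.prems by auto
    from Cons.prems consider "t = s" | r where "r \<in> set (refls ws)" "t = conj_by s r" by auto
    then show ?case
    proof cases
      case 1
      then show ?thesis using l by (intro exI[of _ ws]) (simp add: list_emb_Cons)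
    next
      case 2
      then obtain vs where "subseq vs ws" "Suc (length vs) = length ws" "wp vs = r \<otimes> wp ws"
        using Cons by auto
      moreover have "r \<in> carrier W" using 2 Cons.prems refls_closed by auto
      ultimately show ?thesis using Cons.prems 2
        by (intro exI[of _ "s # vs"]) (auto simp: conj_by_def m_assoc)
    qed
  qed simp
  then show thesis using that by blast
qed

section \<open>Reflections of the Coxeter group\<close>

definition reflections :: "'a set" where
  "reflections = {conj_by u s | u s. u \<in> carrier W \<and> s \<in> S}"

lemma reflections_closed [simp]: "t \<in> reflections \<Longrightarrow> t \<in> carrier W"
  by (auto simp: reflections_def)

lemma reflection_square [simp]: "t \<in> reflections \<Longrightarrow> t \<otimes> t = \<one>"
  unfolding reflections_def using conj_square by blast

lemma reflection_cancel [simp]: "t \<in> reflections \<Longrightarrow> x \<in> carrier W \<Longrightarrow> t \<otimes> (t \<otimes> x) = x"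
  by (simp flip: m_assoc)

lemma gen_reflection [simp]:
  assumes "s \<in> S"
  shows "s \<in> reflections"
proof -
  have "s = conj_by \<one> s" using assms by simp
  then show ?thesis using assms one_closed unfolding reflections_def by blast
qed

lemma conj_reflection:
  assumes "u \<in> carrier W" "t \<in> reflections"
  shows "conj_by u t \<in> reflections"
proof -
  obtain v s where "v \<in> carrier W" "s \<in> S" "t = conj_by v s"
    using assms(2) unfolding reflections_def by blast
  then have "u \<otimes> v \<in> carrier W" "conj_by u t = conj_by (u \<otimes> v) s"
    using assms(1) by (simp_all add: conj_mult)
  then show ?thesis using \<open>s \<in> S\<close> unfolding reflections_def by blast
qed

text \<open>The palindrome \<open>ws @ s # rev ws\<close> represents \<open>t\<close>. Its two outer
  parts contribute an even number of occurrences of \<open>t\<close> in total, because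
  \<open>ws @ rev ws\<close> represents the identity; the middle letter contributes one
  more.\<close>

lemma reflection_word:
  assumes "t \<in> reflections"
  obtains ts where "ts \<in> lists S" "wp ts = t" "odd (count_list (refls ts) t)"
proof -
  obtain u s where us: "u \<in> carrier W" "s \<in> S" "t = conj_by u s"
    using assms unfolding reflections_def by blast
  obtain ws where ws: "ws \<in> lists S" "wp ws = u" using us ex_word by blast
  let ?c = "count_list (refls ws) t"
  have t: "t \<in> carrier W" using us by simp
  have "wp (ws @ rev ws) = wp []"
    using ws us by (simp add: wp_append wp_rev)
  then have "even (count_list (refls (ws @ rev ws)) t) = even (count_list (refls []) t)"
    using ws t by (intro parity_wp) auto
  then have *: "even (?c + count_list (refls (rev ws)) s)"
    using ws t us by (simp add: count_refls_append)
  have "count_list (refls (ws @ s # rev ws)) t =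
     ?c + count_list (refls (s # rev ws)) s"
    using ws t us by (simp add: count_refls_append)
  also have "count_list (refls (s # rev ws)) s = Suc (count_list (refls (rev ws)) s)"
    using ws us count_map_conj[of s s "refls (rev ws)"] refls_closed[of "rev ws"] by simp
  finally have "odd (count_list (refls (ws @ s # rev ws)) t)" using * by simp
  moreover have "wp (ws @ s # rev ws) = t"
    using ws us by (simp add: wp_append wp_rev conj_by_def m_assoc)
  ultimately show thesis using that[of "ws @ s # rev ws"] ws us by simp
qed

section \<open>Length, reduced words and descents\<close>

definition reduced :: "'a list \<Rightarrow> bool" where
  "reduced ws \<longleftrightarrow> ws \<in> lists S \<and> length ws = len (wp ws)"

lemma len_le: "ws \<in> lists S \<Longrightarrow> len (wp ws) \<le> length ws"
  unfolding cox_length_def by (rule Least_le) blast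

lemma reduced_expr_iff: "reduced_expr W S ws w \<longleftrightarrow> reduced ws \<and> wp ws = w"
  by (auto simp: reduced_expr_def reduced_def)

lemma reduced_lists: "reduced ws \<Longrightarrow> ws \<in> lists S"
  by (simp add: reduced_def)

lemma reduced_length: "reduced ws \<Longrightarrow> len (wp ws) = length ws"
  by (simp add: reduced_def)

lemma ex_reduced:
  assumes "x \<in> carrier W"
  obtains ws where "reduced ws" "wp ws = x"
proof -
  obtain us where "us \<in> lists S" "wp us = x" using assms ex_word by blast
  then have "\<exists>n. \<exists>ws\<in>lists S. length ws = n \<and> wp ws = x" by blast
  then have "\<exists>ws\<in>lists S. length ws = len x \<and> wp ws = x"
    unfolding cox_length_def by (rule LeastI_ex)
  then show thesis using that by (auto simp: reduced_def)
qed

lemma len_mult_le: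
  assumes "x \<in> carrier W" "y \<in> carrier W"
  shows "len (x \<otimes> y) \<le> len x + len y"
proof -
  obtain us vs where "reduced us" "wp us = x" "reduced vs" "wp vs = y"
    using assms ex_reduced by metis
  then show ?thesis
    using len_le[of "us @ vs"] by (auto simp: wp_append reduced_def)
qed

lemma len_gen_le: "s \<in> S \<Longrightarrow> len s \<le> 1"
  using len_le[of "[s]"] by simp

lemma len_one [simp]: "len \<one> = 0"
  using len_le[of "[]"] by simp

lemma reduced_ConsD:
  assumes "reduced (s # ws)"
  shows "reduced ws"
proof -
  have l: "s \<in> S" "ws \<in> lists S" using reduced_lists[OF assms] by auto
  have "Suc (length ws) \<le> 1 + len (wp ws)"
    using len_mult_le[of s "wp ws"] len_gen_le[of s] reduced_length[OF assms] l by simp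
  then show ?thesis using len_le[OF l(2)] l by (simp add: reduced_def)
qed

text \<open>Parity carries over to a reduced word of the same element. There an odd count forces an
  occurrence of \<open>t\<close>, and deleting its letter shortens the word.\<close>

lemma shorter_if_odd:
  assumes "ws \<in> lists S" "t \<in> carrier W" "odd (count_list (refls ws) t)"
  shows "len (t \<otimes> wp ws) < len (wp ws)"
proof -
  obtain rs where rs: "reduced rs" "wp rs = wp ws"
    using assms(1) ex_reduced[of "wp ws"] by auto
  have l: "rs \<in> lists S" by (rule reduced_lists[OF rs(1)])
  have "odd (count_list (refls rs) t)"
    using parity_wp[OF l assms(1) rs(2) assms(2)] assms(3) by simp
  then have "t \<in> set (refls rs)"
    using count_list_0_iff[of "refls rs" t] by force
  then obtain vs where vs: "subseq vs rs" "Suc (length vs) = length rs" "wp vs = t \<otimes> wp rs"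
    using refls_delete[OF l] by blast
  then show ?thesis
    using len_le[OF subseq_lists[OF vs(1) l]] reduced_length[OF rs(1)] rs(2) by simp
qed

text \<open>Prepending a word of \<open>t\<close> with odd count makes the total count odd, as
  conjugation by \<open>t\<close> fixes \<open>t\<close>. So \<open>shorter_if_odd\<close> applies
  to \<open>t\<close> times the element, and \<open>t\<close> is an involution.\<close>

lemma longer_if_even:
  assumes "ws \<in> lists S" "t \<in> reflections" "even (count_list (refls ws) t)"
  shows "len (wp ws) < len (t \<otimes> wp ws)"
proof -
  obtain ts where ts: "ts \<in> lists S" "wp ts = t" "odd (count_list (refls ts) t)"
    using reflection_word[OF assms(2)] .
  have "t \<in> carrier W" using assms(2) by simp
  moreover from this have "conj_by (inv t) t = t"
    using conj_inv_cancel(1)[of t t] by simp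
  ultimately have "odd (count_list (refls (ts @ ws)) t)"
    using ts assms by (simp add: count_refls_append)
  moreover have "ts @ ws \<in> lists S" "wp (ts @ ws) = t \<otimes> wp ws"
    using ts assms by (auto simp: wp_append)
  ultimately show ?thesis
    using shorter_if_odd[of "ts @ ws" t] assms by simp
qed

lemma shorter_iff_odd:
  assumes "ws \<in> lists S" "t \<in> reflections"
  shows "len (t \<otimes> wp ws) < len (wp ws) \<longleftrightarrow> odd (count_list (refls ws) t)"
  using shorter_if_odd[OF assms(1)] longer_if_even[OF assms] assms(2)
  by (meson reflections_closed order_less_asym)

lemma strong_exchange:
  assumes "ws \<in> lists S" "t \<in> reflections" "len (t \<otimes> wp ws) < len (wp ws)"
  shows "t \<in> set (refls ws)"
  using assms shorter_iff_odd[OF assms(1,2)] count_list_0_iff[of "refls ws" t] by force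

text \<open>The parity of the count decides between the two cases, so left multiplication by a
  reflection never preserves length.\<close>

lemma len_reflection_cases:
  assumes "x \<in> carrier W" "t \<in> reflections"
  shows "len (t \<otimes> x) < len x \<or> len x < len (t \<otimes> x)"
proof -
  obtain ws where "ws \<in> lists S" "wp ws = x" using assms(1) ex_word by blast
  then show ?thesis using shorter_if_odd[of ws t] longer_if_even[of ws t] assms(2) by auto
qed

abbreviation descent :: "'a \<Rightarrow> 'a \<Rightarrow> bool" where
  "descent s x \<equiv> len (s \<otimes> x) < len x"

lemma len_gen_mult_le: "s \<in> S \<Longrightarrow> x \<in> carrier W \<Longrightarrow> len (s \<otimes> x) \<le> Suc (len x)"
  using len_mult_le[of s x] len_gen_le[of s] by simp

lemma descent_len: "s \<in> S \<Longrightarrow> x \<in> carrier W \<Longrightarrow> descent s x \<Longrightarrow> len x = Suc (len (s \<otimes> x))"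
  using len_gen_mult_le[of s "s \<otimes> x"] by simp

lemma not_descent_len:
  "s \<in> S \<Longrightarrow> x \<in> carrier W \<Longrightarrow> \<not> descent s x \<Longrightarrow> len (s \<otimes> x) = Suc (len x)"
  using len_gen_mult_le[of s x] len_reflection_cases[of x s] by simp

lemma reduced_Cons_iff:
  "reduced (s # ws) \<longleftrightarrow> s \<in> S \<and> reduced ws \<and> \<not> descent s (wp ws)"
proof
  assume r: "reduced (s # ws)"
  then have "reduced ws" by (rule reduced_ConsD)
  then show "s \<in> S \<and> reduced ws \<and> \<not> descent s (wp ws)"
    using reduced_length[OF r] reduced_length[of ws] reduced_lists[OF r] by simp
next
  assume "s \<in> S \<and> reduced ws \<and> \<not> descent s (wp ws)"
  then show "reduced (s # ws)"
    using not_descent_len[of s "wp ws"] by (auto simp: reduced_def)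
qed

lemma reduced_ConsI:
  assumes "s \<in> S" "x \<in> carrier W" "descent s x"
  obtains ws where "reduced (s # ws)" "wp ws = s \<otimes> x" "wp (s # ws) = x"
proof -
  obtain ws where "reduced ws" "wp ws = s \<otimes> x" using assms ex_reduced[of "s \<otimes> x"] by auto
  then show thesis using assms that[of ws] by (simp add: reduced_Cons_iff)
qed


text \<open>The word is read from its end while a reduced subword is maintained: a new letter is put
  in front if this lengthens the product, and otherwise the exchange condition removes an old
  letter.\<close>

lemma reduced_subword:
  assumes "ws \<in> lists S"
  shows "\<exists>vs. subseq vs ws \<and> reduced vs \<and> wp vs = wp ws"
  using assms
proof (induction ws rule: list.induct)
  case Nil
  then show ?case by (intro exI[of _ "[]"]) (simp add: reduced_def)
next
  case (Cons s ws)
  then obtain vs where vs: "subseq vs ws" "reduced vs" "wp vs = wp ws" by auto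
  have l: "s \<in> S" "vs \<in> lists S" using Cons.prems reduced_lists[OF vs(2)] by auto
  show ?case
  proof (cases "descent s (wp vs)")
    case False
    then have "reduced (s # vs)" using vs l by (simp add: reduced_Cons_iff)
    then show ?thesis using vs by (intro exI[of _ "s # vs"]) simp
  next
    case True
    then obtain us where us: "subseq us vs" "Suc (length us) = length vs" "wp us = s \<otimes> wp vs"
      using refls_delete[OF l(2)] strong_exchange[OF l(2)] l by (metis gen_reflection)
    have "us \<in> lists S" by (rule subseq_lists[OF us(1) l(2)])
    moreover have "length us = len (wp us)"
      using descent_len[OF _ _ True] l us(2,3) reduced_length[OF vs(2)] by simp
    ultimately have "reduced us" by (simp add: reduced_def)
    moreover have "subseq us (s # ws)"
      using us(1) vs(1) by (meson list_emb_Cons subseq_order.order_trans)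
    ultimately show ?thesis using us vs by (intro exI[of _ us]) simp
  qed
qed

section \<open>The Bruhat order\<close>

text \<open>Steps multiply by an arbitrary reflection and may raise the length by more than one. The
  reflexive transitive closure is matched with the subword definition in
  \<open>bruhat_le_iff\<close>.\<close>

definition bruhat_step :: "'a \<Rightarrow> 'a \<Rightarrow> bool" where
  "bruhat_step x y \<longleftrightarrow> x \<in> carrier W \<and> len x < len y \<and> (\<exists>t\<in>reflections. y = t \<otimes> x)"

abbreviation bruhat :: "'a \<Rightarrow> 'a \<Rightarrow> bool" where
  "bruhat \<equiv> bruhat_step\<^sup>*\<^sup>*"

lemma bruhat_stepD: "bruhat_step x y \<Longrightarrow> x \<in> carrier W \<and> y \<in> carrier W \<and> len x < len y"
  by (auto simp: bruhat_step_def)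

lemma bruhat_step_gen: "s \<in> S \<Longrightarrow> x \<in> carrier W \<Longrightarrow> \<not> descent s x \<Longrightarrow> bruhat_step x (s \<otimes> x)"
  unfolding bruhat_step_def using not_descent_len[of s x] gen_reflection by auto

lemma bruhat_step_descent: "s \<in> S \<Longrightarrow> x \<in> carrier W \<Longrightarrow> descent s x \<Longrightarrow> bruhat_step (s \<otimes> x) x"
  using bruhat_step_gen[of s "s \<otimes> x"] by simp

lemma bruhat_carrier: "bruhat x y \<Longrightarrow> x \<in> carrier W \<longleftrightarrow> y \<in> carrier W"
  by (induction rule: rtranclp_induct) (auto dest: bruhat_stepD)

lemma bruhat_len: "bruhat x y \<Longrightarrow> x = y \<or> len x < len y"
  by (induction rule: rtranclp_induct) (auto dest: bruhat_stepD)

text \<open>If \<open>t = s\<close>, then \<open>s x = y\<close>; if \<open>s\<close> is a descent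
  of \<open>x\<close>, then \<open>s x < x < y\<close>. Otherwise \<open>s y\<close> arises from
  \<open>s x\<close> by the reflection \<open>s t s\<close>, and only the direction of the length
  change is at stake.\<close>

lemma bruhat_step_gen_mult:
  assumes "bruhat_step x y" "s \<in> S"
  shows "bruhat (s \<otimes> x) y \<or> bruhat (s \<otimes> x) (s \<otimes> y)"
proof -
  obtain t where t: "t \<in> reflections" "y = t \<otimes> x" and x: "x \<in> carrier W" "len x < len y"
    using assms(1) by (auto simp: bruhat_step_def)
  have y: "y \<in> carrier W" using t x by simp
  consider "t = s" | "descent s x" | "t \<noteq> s" "\<not> descent s x" by blast
  then show ?thesis
  proof cases
    case 1
    then show ?thesis using t by simp
  next
    case 2
    then have "bruhat_step (s \<otimes> x) x" using x assms by (intro bruhat_step_descent)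
    then show ?thesis using assms(1) by auto
  next
    case 3
    let ?r = "conj_by s t"
    have r: "?r \<in> reflections" using t assms(2) by (simp add: conj_reflection)
    have sy: "s \<otimes> y = ?r \<otimes> (s \<otimes> x)"
      using t x assms(2) by (simp add: conj_by_def m_assoc)
    obtain ws where ws: "reduced ws" "wp ws = x" using x ex_reduced by blast
    have l: "s # ws \<in> lists S" using reduced_lists[OF ws(1)] assms(2) by simp
    \<comment> \<open>If the length dropped, strong exchange would find \<open>s t s\<close> among
      the reflections of \<open>s # ws\<close>. It differs from \<open>s\<close>, hence
      \<open>t\<close> belongs to \<open>ws\<close>, and deleting its letter makes \<open>y\<close>
      shorter than \<open>x\<close>.\<close>
    have "\<not> len (s \<otimes> y) < len (s \<otimes> x)"
    proof
      assume "len (s \<otimes> y) < len (s \<otimes> x)"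
      then have "?r \<in> set (refls (s # ws))"
        using strong_exchange[OF l r] ws(2) sy by simp
      moreover have "?r \<noteq> s"
        using 3(1) t(1) assms(2) by (metis gen_conj_conj conj_self reflections_closed S_closed)
      ultimately obtain q where q: "q \<in> set (refls ws)" "?r = conj_by s q" by auto
      have "q \<in> carrier W" using q(1) refls_closed[of ws] l by auto
      then have "t = q" using q(2) t(1) assms(2) by (metis gen_conj_conj reflections_closed)
      then obtain vs where vs: "subseq vs ws" "Suc (length vs) = length ws" "wp vs = t \<otimes> wp ws"
        using refls_delete[of ws t] q(1) l by auto
      then have "len y < len x"
        using len_le[OF subseq_lists[OF vs(1) reduced_lists[OF ws(1)]]] reduced_length[OF ws(1)] ws(2) t
        by simp
      then show False using x by simp
    qed
    then have "bruhat_step (s \<otimes> x) (s \<otimes> y)"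
      unfolding bruhat_step_def
      using len_reflection_cases[OF _ r, of "s \<otimes> x"] sy x assms(2) r by auto
    then show ?thesis by blast
  qed
qed

lemma bruhat_gen_mult:
  assumes "bruhat x y" "s \<in> S"
  shows "bruhat (s \<otimes> x) y \<or> bruhat (s \<otimes> x) (s \<otimes> y)"
  using assms(1)
proof (induction rule: rtranclp_induct)
  case (step y z)
  then show ?case using bruhat_step_gen_mult[OF step.hyps(2) assms(2)] by (meson rtranclp.rtrancl_into_rtrancl rtranclp_trans)
qed simp

lemma bruhat_gen_mult_descent:
  assumes "bruhat x y" "s \<in> S" "y \<in> carrier W" "descent s y"
  shows "bruhat (s \<otimes> x) y"
  using bruhat_gen_mult[OF assms(1,2)] bruhat_step_descent[OF assms(2-4)] by auto

text \<open>Omitting the first letter \<open>s\<close> costs one step up from \<open>wp ws\<close>,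
  keeping it is \<open>bruhat_gen_mult\<close>. The subword may be non-reduced, as happens for
  expansions of words of \<open>Wt\<close>.\<close>

lemma subword_bruhat:
  assumes "reduced ws" "subseq vs ws"
  shows "bruhat (wp vs) (wp ws)"
  using assms
proof (induction ws arbitrary: vs)
  case (Cons s ws)
  then have r: "reduced ws" "s \<in> S" "\<not> descent s (wp ws)" by (simp_all add: reduced_Cons_iff)
  then have up: "bruhat_step (wp ws) (s \<otimes> wp ws)"
    using reduced_lists[OF r(1)] by (intro bruhat_step_gen) auto
  from Cons.prems(2) consider "subseq vs ws" | us where "vs = s # us" "subseq us ws"
    by (cases vs) (auto split: if_splits)
  then show ?case
  proof cases
    case 1
    from rtranclp.rtrancl_into_rtrancl[where r = bruhat_step, OF Cons.IH[OF r(1) 1] up]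
    show ?thesis by simp
  next
    case 2
    then show ?thesis
      using bruhat_gen_mult[OF Cons.IH[OF r(1) 2(2)] r(2)] up by auto
  qed
qed (auto dest: list_emb_Nil2)

text \<open>Going down a chain, strong exchange deletes one letter for each step, and the result is
  thinned to a reduced subword. With \<open>subword_bruhat\<close> this makes the choice of the
  reduced word of the larger element immaterial.\<close>

lemma bruhat_subword:
  assumes "bruhat x (wp ws)" "ws \<in> lists S"
  shows "\<exists>vs. subseq vs ws \<and> reduced vs \<and> wp vs = x"
  using assms(1)
proof (induction rule: converse_rtranclp_induct)
  case base
  then show ?case by (rule reduced_subword[OF assms(2)])
next
  case (step x y)
  then obtain vs where vs: "subseq vs ws" "reduced vs" "wp vs = y" by blast
  have l: "vs \<in> lists S" by (rule reduced_lists[OF vs(2)])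
  obtain t where t: "t \<in> reflections" "y = t \<otimes> x" "x \<in> carrier W" "len x < len y"
    using step.hyps(1) by (auto simp: bruhat_step_def)
  then have "x = t \<otimes> y" by simp
  then have "t \<in> set (refls vs)"
    using strong_exchange[OF l t(1)] vs(3) t by simp
  then obtain us where us: "subseq us vs" "wp us = x"
    using refls_delete[OF l] vs(3) \<open>x = t \<otimes> y\<close> by metis
  have "us \<in> lists S" by (rule subseq_lists[OF us(1) l])
  from reduced_subword[OF this] obtain rs where "subseq rs us" "reduced rs" "wp rs = wp us" by blast
  then show ?case using us vs by (meson subseq_order.order_trans)
qed

lemma bruhat_le_iff:
  assumes "y \<in> carrier W"
  shows "bruhat_le W S x y \<longleftrightarrow> bruhat x y"
proof
  assume "bruhat_le W S x y"
  then show "bruhat x y"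
    unfolding bruhat_le_def reduced_expr_iff
    using subword_bruhat by blast
next
  assume *: "bruhat x y"
  obtain ws where ws: "reduced ws" "wp ws = y" using assms ex_reduced by blast
  then obtain vs where "subseq vs ws" "reduced vs" "wp vs = x"
    using bruhat_subword[of x ws] * reduced_lists[OF ws(1)] by blast
  then show "bruhat_le W S x y" using ws unfolding bruhat_le_def reduced_expr_iff by blast
qed

text \<open>In a reduced word of \<open>y\<close> that starts with \<open>s\<close>, a reduced
  subword for \<open>x\<close> either avoids this letter, whence \<open>x \<le> s y\<close>, or
  begins with it, and then its remainder represents \<open>s x\<close>.\<close>

lemma lifting:
  assumes "bruhat x y" "s \<in> S" "y \<in> carrier W" "descent s y"
  shows "bruhat (if descent s x then s \<otimes> x else x) (s \<otimes> y)"
proof -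
  obtain ws where ws: "reduced (s # ws)" "wp ws = s \<otimes> y" "wp (s # ws) = y"
    using reduced_ConsI[OF assms(2-4)] .
  have r: "reduced ws" "ws \<in> lists S" "\<not> descent s (wp ws)"
    using ws(1) reduced_lists[of ws] by (simp_all add: reduced_Cons_iff)
  have x: "x \<in> carrier W" using bruhat_carrier assms by blast
  obtain vs where vs: "subseq vs (s # ws)" "reduced vs" "wp vs = x"
    using bruhat_subword[of x "s # ws"] ws(3) assms reduced_lists[OF ws(1)] by metis
  from vs(1) consider "subseq vs ws" | us where "vs = s # us" "subseq us ws"
    by (cases vs) (auto split: if_splits)
  then show ?thesis
  proof cases
    case 1
    then have "bruhat x (s \<otimes> y)" using subword_bruhat[OF r(1)] vs ws by metis
    moreover have "bruhat (s \<otimes> x) x" if "descent s x"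
      using that bruhat_step_descent[OF assms(2) x] by blast
    ultimately show ?thesis by (auto intro: rtranclp_trans)
  next
    case 2
    then have us: "reduced us" "us \<in> lists S" "\<not> descent s (wp us)"
      using vs(2) reduced_lists[of us] by (simp_all add: reduced_Cons_iff)
    then have "wp us = s \<otimes> x" using vs(3) 2 assms(2) by auto
    moreover have "descent s x" using vs(3) us 2 assms(2) not_descent_len[of s "wp us"] by auto
    moreover have "bruhat (wp us) (s \<otimes> y)" using subword_bruhat[OF r(1) 2(2)] ws(2) by simp
    ultimately show ?thesis by simp
  qed
qed

section \<open>Parabolic subgroups\<close>

lemma generate_carrier: "J \<subseteq> S \<Longrightarrow> x \<in> generate W J \<Longrightarrow> x \<in> carrier W"
  using generate_in_carrier[of J] S_carrier by blast

lemma generate_gen_mult: "s \<in> J \<Longrightarrow> x \<in> generate W J \<Longrightarrow> s \<otimes> x \<in> generate W J"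
  by (rule generate.eng[OF generate.incl])

lemma generate_inv: "J \<subseteq> S \<Longrightarrow> x \<in> generate W J \<Longrightarrow> inv x \<in> generate W J"
  using generate_m_inv_closed[of J x] S_carrier by blast

lemma generate_conj:
  "J \<subseteq> S \<Longrightarrow> u \<in> generate W J \<Longrightarrow> x \<in> generate W J \<Longrightarrow> conj_by u x \<in> generate W J"
  unfolding conj_by_def by (rule generate.eng[OF generate.eng generate_inv])

text \<open>Thinning a word over \<open>J\<close> stays within \<open>J\<close>. Thus elements of
  the parabolic subgroup have words over \<open>J\<close> that are reduced in all of
  \<open>W\<close>.\<close>

lemma generate_reduced_word:
  assumes "J \<subseteq> S" "x \<in> generate W J"
  obtains ws where "ws \<in> lists J" "reduced ws" "wp ws = x"
proof -
  obtain us where us: "us \<in> lists J" "wp us = x"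
    using assms generate_words[OF assms(1)] by auto
  then have "us \<in> lists S" using assms(1) by auto
  from reduced_subword[OF this] obtain vs where "subseq vs us" "reduced vs" "wp vs = wp us" by blast
  then show thesis using that us subseq_lists[of vs us J] by metis
qed

lemma ex_descent_generate:
  assumes "J \<subseteq> S" "x \<in> generate W J" "x \<noteq> \<one>"
  shows "\<exists>s\<in>J. descent s x"
proof -
  obtain ws where ws: "ws \<in> lists J" "reduced ws" "wp ws = x"
    using generate_reduced_word[OF assms(1,2)] .
  then obtain s us where us: "ws = s # us" using assms(3) by (cases ws) auto
  then have "s \<in> J" "s \<in> S" "reduced us" "\<not> descent s (wp us)"
    using ws by (auto simp: reduced_Cons_iff)
  then have "descent s x"
    using ws us not_descent_len[of s "wp us"] reduced_lists[of us] by auto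
  then show ?thesis using \<open>s \<in> J\<close> by blast
qed

lemma bruhat_one: "x \<in> carrier W \<Longrightarrow> bruhat \<one> x"
  using ex_reduced[of x] subword_bruhat[of _ "[]"] by (metis list_emb_Nil wp_Nil)

text \<open>Starting from the identity, multiplication by a letter of \<open>J\<close> never leaves
  the elements below \<open>x\<close>, since every such letter is a descent of
  \<open>x\<close>.\<close>

lemma bruhat_all_descents:
  assumes "J \<subseteq> S" "x \<in> carrier W" "\<forall>s\<in>J. descent s x" "u \<in> generate W J"
  shows "bruhat u x"
proof -
  obtain ws where ws: "ws \<in> lists J" "wp ws = u"
    using assms(4) generate_words[OF assms(1)] by auto
  from ws(1) have "bruhat (wp ws) x"
  proof (induction ws rule: list.induct)
    case Nil
    then show ?case using bruhat_one[OF assms(2)] by simp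
  next
    case (Cons s ws)
    then show ?case using bruhat_gen_mult_descent[of "wp ws" x s] assms by auto
  qed
  then show ?thesis using ws by simp
qed

text \<open>By \<open>bruhat_all_descents\<close> all other elements of the subgroup are strictly
  shorter than \<open>x\<close>, which settles the uniqueness in the definite description.\<close>

lemma longest_elt_eq:
  assumes "J \<subseteq> S" "x \<in> generate W J" "\<forall>s\<in>J. descent s x"
  shows "longest_elt W S J = x"
proof -
  have "u = x \<or> len u < len x" if "u \<in> generate W J" for u
    using bruhat_all_descents[OF assms(1) _ assms(3) that] bruhat_len generate_carrier assms by blast
  then show ?thesis
    unfolding longest_elt_def using assms(2)
    by (intro the_equality) (force dest: leD)+
qed

text \<open>Finiteness provides an element of maximal length. Multiplication by \<open>s\<close> in
  \<open>J\<close> stays in the subgroup and must change the length, so it shortens.\<close>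

lemma longest_elt:
  assumes "J \<subseteq> S" "finite (generate W J)"
  shows "longest_elt W S J \<in> generate W J" "\<forall>s\<in>J. descent s (longest_elt W S J)"
proof -
  let ?A = "len ` generate W J"
  have "Max ?A \<in> ?A" using assms(2) generate.one[of W J] by (intro Max_in) auto
  then obtain x where x: "x \<in> generate W J" "len x = Max ?A" by auto
  have d: "\<forall>s\<in>J. descent s x"
  proof
    fix s assume s: "s \<in> J"
    then have "s \<otimes> x \<in> generate W J" using x by (intro generate_gen_mult)
    then have "len (s \<otimes> x) \<le> len x" using assms(2) x(2) by simp
    then show "descent s x"
      using len_reflection_cases[of x s] generate_carrier[OF assms(1) x(1)] s assms(1) by auto
  qed
  show "longest_elt W S J \<in> generate W J" "\<forall>s\<in>J. descent s (longest_elt W S J)"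
    using longest_elt_eq[OF assms(1) x(1) d] x d by simp_all
qed

lemma refls_generate:
  assumes "J \<subseteq> S" "ws \<in> lists J"
  shows "set (refls ws) \<subseteq> generate W J"
  using assms(2)
proof (induction ws rule: list.induct)
  case (Cons s ws)
  then have "s \<in> generate W J" by (auto intro: generate.incl)
  then show ?case using Cons generate_conj[OF assms(1)] by auto
qed simp

text \<open>If a further letter \<open>s\<close> shortened the product, strong exchange would delete
  a letter of \<open>ws\<close>, contradicting that \<open>s # ws\<close> is reduced, or one of
  \<open>bs\<close>, contradicting the minimality of \<open>b\<close> in its coset.\<close>

lemma len_mult_coset_minimum:
  assumes "J \<subseteq> S" "b \<in> carrier W" "\<forall>a\<in>generate W J. len b \<le> len (a \<otimes> b)"
    and "ws \<in> lists J" "reduced ws"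
  shows "len (wp ws \<otimes> b) = length ws + len b"
  using assms(4,5)
proof (induction ws rule: list.induct)
  case Nil
  then show ?case using assms(2) by simp
next
  case (Cons s ws)
  then have s: "s \<in> J" "s \<in> S" "\<not> descent s (wp ws)" and ws: "ws \<in> lists J" "reduced ws"
    and IH: "len (wp ws \<otimes> b) = length ws + len b"
    by (auto simp: reduced_Cons_iff)
  have l: "ws \<in> lists S" by (rule reduced_lists[OF ws(2)])
  obtain bs where bs: "reduced bs" "wp bs = b" using assms(2) ex_reduced by blast
  have lb: "bs \<in> lists S" by (rule reduced_lists[OF bs(1)])
  let ?a = "wp ws"
  have a: "?a \<in> carrier W" "?a \<in> generate W J"
    using l ws generate_words[OF assms(1)] by auto
  have "\<not> descent s (?a \<otimes> b)"
  proof
    assume "descent s (?a \<otimes> b)"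
    then have "s \<in> set (refls (ws @ bs))"
      using l lb s bs by (intro strong_exchange) (auto simp: wp_append)
    then consider "s \<in> set (refls ws)" | r where "r \<in> set (refls bs)" "s = conj_by ?a r"
      using l lb by (auto simp: refls_append)
    then show False
    proof cases
      case 1
      then obtain vs where vs: "subseq vs ws" "Suc (length vs) = length ws" "wp vs = s \<otimes> ?a"
        using refls_delete[OF l] by blast
      then show False
        using len_le[OF subseq_lists[OF vs(1) l]] reduced_length[OF ws(2)] s by simp
    next
      case 2
      then obtain vs where vs: "subseq vs bs" "Suc (length vs) = length bs" "wp vs = r \<otimes> b"
        using refls_delete[OF lb] bs(2) by blast
      then have "len (r \<otimes> b) < len b"
        using len_le[OF subseq_lists[OF vs(1) lb]] reduced_length[OF bs(1)] bs(2) by simp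
      moreover have "len b \<le> len (r \<otimes> b)"
      proof -
        have "r \<in> carrier W" using 2 refls_closed[OF lb] by blast
        \<comment> \<open>The deleting reflection is conjugate to \<open>s\<close> inside the
          parabolic subgroup, so \<open>r b\<close> lies in the coset of \<open>b\<close>.\<close>
        then have "r = conj_by (inv ?a) s" using 2 a by simp
        then have "r \<in> generate W J"
          using generate_conj[OF assms(1) generate_inv[OF assms(1) a(2)] generate.incl[OF s(1)]] by simp
        then show ?thesis using assms(3) by blast
      qed
      ultimately show False by simp
    qed
  qed
  then show ?case
    using not_descent_len[of s "?a \<otimes> b"] s a assms(2) IH by (simp add: m_assoc)
qed

text \<open>Lengths add over a shortest element \<open>c b\<close> of the coset. If \<open>c\<close>
  were nontrivial, a descent of \<open>inv c\<close> would by this additivity be a descent of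
  \<open>b = inv c (c b)\<close>; so \<open>b\<close> itself is shortest.\<close>

lemma len_mult_no_descent:
  assumes "J \<subseteq> S" "b \<in> carrier W" "\<forall>s\<in>J. \<not> descent s b" "a \<in> generate W J"
  shows "len (a \<otimes> b) = len a + len b"
proof -
  obtain c where c: "c \<in> generate W J" "\<And>d. d \<in> generate W J \<Longrightarrow> len (c \<otimes> b) \<le> len (d \<otimes> b)"
    using ex_has_least_nat[of "\<lambda>c. c \<in> generate W J" \<one> "\<lambda>c. len (c \<otimes> b)"] generate.one[of W J]
    by blast
  have cc: "c \<in> carrier W" by (rule generate_carrier[OF assms(1) c(1)])
  have add: "len (d \<otimes> (c \<otimes> b)) = len d + len (c \<otimes> b)" if "d \<in> generate W J" for d
  proof -
    obtain ws where ws: "ws \<in> lists J" "reduced ws" "wp ws = d"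
      using generate_reduced_word[OF assms(1) \<open>d \<in> generate W J\<close>] .
    have "\<forall>e\<in>generate W J. len (c \<otimes> b) \<le> len (e \<otimes> (c \<otimes> b))"
    proof
      fix e assume e: "e \<in> generate W J"
      then have "len (c \<otimes> b) \<le> len ((e \<otimes> c) \<otimes> b)" using c by (intro c(2) generate.eng)
      then show "len (c \<otimes> b) \<le> len (e \<otimes> (c \<otimes> b))"
        using cc assms(2) generate_carrier[OF assms(1) e] by (simp add: m_assoc)
    qed
    from len_mult_coset_minimum[OF assms(1) _ this ws(1,2)] show ?thesis
      using ws reduced_length[OF ws(2)] cc assms(2) by simp
  qed
  have ic: "inv c \<in> generate W J" by (rule generate_inv[OF assms(1) c(1)])
  have icb: "inv c \<otimes> (c \<otimes> b) = b" using cc assms(2) by (simp flip: m_assoc)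
  have "inv c = \<one>"
  proof (rule ccontr)
    assume "inv c \<noteq> \<one>"
    then obtain s where s: "s \<in> J" "descent s (inv c)"
      using ex_descent_generate[OF assms(1) ic] by blast
    have "len ((s \<otimes> inv c) \<otimes> (c \<otimes> b)) = len (s \<otimes> inv c) + len (c \<otimes> b)"
      using s ic by (intro add generate_gen_mult)
    moreover have "(s \<otimes> inv c) \<otimes> (c \<otimes> b) = s \<otimes> b"
      using s assms(1,2) cc icb by (simp add: m_assoc subsetD)
    ultimately have "descent s b" using add[OF ic] icb s by simp
    then show False using s assms(3) by blast
  qed
  then have "c = \<one>" using cc by simp
  then show ?thesis using add[OF assms(4)] assms(2) by simp
qed

text \<open>Additivity of lengths makes each letter of the prefix a descent of the right-hand side
  when its turn comes. It is not a descent of \<open>x\<close>, so lifting removes it on the right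
  and leaves \<open>x\<close> alone.\<close>

lemma bruhat_cancel_prefix:
  assumes "b \<in> carrier W" "ws \<in> lists S" "len (wp ws \<otimes> b) = length ws + len b"
    and "bruhat x (wp ws \<otimes> b)" "\<forall>s\<in>set ws. \<not> descent s x"
  shows "bruhat x b"
  using assms(2-)
proof (induction ws rule: list.induct)
  case Nil
  then show ?case using assms(1) by simp
next
  case (Cons s ws)
  let ?y = "wp ws \<otimes> b"
  have l: "s \<in> S" "ws \<in> lists S" "?y \<in> carrier W" using Cons assms(1) by auto
  have sy: "wp (s # ws) \<otimes> b = s \<otimes> ?y" using l assms(1) by (simp add: m_assoc)
  \<comment> \<open>The length of the whole product meets the upper bound, so the bounds for the
    tail and for the last letter are equalities.\<close>
  have "len ?y \<le> length ws + len b"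
    using len_mult_le[of "wp ws" b] len_le[of ws] l assms(1) by simp
  moreover have "len (s \<otimes> ?y) = Suc (length ws + len b)" using Cons.prems(2) sy by simp
  moreover have "len (s \<otimes> ?y) \<le> Suc (len ?y)" using len_gen_mult_le[of s ?y] l by simp
  ultimately have len: "len ?y = length ws + len b" "len (s \<otimes> ?y) = Suc (len ?y)" by simp_all
  then have "descent s (s \<otimes> ?y)" using l by simp
  moreover have "bruhat x (s \<otimes> ?y)" using Cons.prems(3) sy by simp
  ultimately have "bruhat x ?y"
    using lifting[of x "s \<otimes> ?y" s] l Cons.prems(4) by simp
  then show ?case using Cons.IH len Cons.prems(4) l by simp
qed

text \<open>Here each letter is a descent on both sides, so lifting removes it from both.\<close>

lemma bruhat_cancel_common_prefix:
  assumes "a \<in> carrier W" "b \<in> carrier W" "ws \<in> lists S"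
    and "len (wp ws \<otimes> a) = length ws + len a" "len (wp ws \<otimes> b) = length ws + len b"
    and "bruhat (wp ws \<otimes> a) (wp ws \<otimes> b)"
  shows "bruhat a b"
  using assms(3-)
proof (induction ws rule: list.induct)
  case Nil
  then show ?case using assms(1,2) by simp
next
  case (Cons s ws)
  have len: "len (wp ws \<otimes> c) = length ws + len c \<and> len (s \<otimes> (wp ws \<otimes> c)) = Suc (len (wp ws \<otimes> c))
      \<and> wp (s # ws) \<otimes> c = s \<otimes> (wp ws \<otimes> c)"
    if "c \<in> carrier W" "len (wp (s # ws) \<otimes> c) = length (s # ws) + len c" for c
  proof -
    have l: "s \<in> S" "ws \<in> lists S" "wp ws \<otimes> c \<in> carrier W" using Cons that by auto
    then have "wp (s # ws) \<otimes> c = s \<otimes> (wp ws \<otimes> c)" using that by (simp add: m_assoc)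
    then show ?thesis
      using that(2) len_mult_le[of "wp ws" c] len_le[of ws] len_gen_mult_le[of s "wp ws \<otimes> c"] l that(1)
      by simp
  qed
  have l: "s \<in> S" "wp ws \<otimes> a \<in> carrier W" "wp ws \<otimes> b \<in> carrier W" using Cons assms(1,2) by auto
  note la = len[OF assms(1) Cons.prems(2)] and lb = len[OF assms(2) Cons.prems(3)]
  have "bruhat (s \<otimes> (wp ws \<otimes> a)) (s \<otimes> (wp ws \<otimes> b))"
    using Cons.prems(4) la lb by simp
  then have "bruhat (wp ws \<otimes> a) (wp ws \<otimes> b)"
    using lifting[of "s \<otimes> (wp ws \<otimes> a)" "s \<otimes> (wp ws \<otimes> b)" s] l la lb by simp
  then show ?case using Cons.IH Cons.prems(1) la lb by simp
qed

end

section \<open>Folding by an involution\<close>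

locale folding = coxeter W S for W :: "('a, 'x) monoid_scheme" (structure) and S :: "'a set" +
  fixes \<theta> :: "'a \<Rightarrow> 'a"
  assumes theta_hom: "\<theta> \<in> hom W W"
    and theta_theta [simp]: "x \<in> carrier W \<Longrightarrow> \<theta> (\<theta> x) = x"
    and theta_S: "\<theta> ` S = S"
begin

lemma theta_mult: "x \<in> carrier W \<Longrightarrow> y \<in> carrier W \<Longrightarrow> \<theta> (x \<otimes> y) = \<theta> x \<otimes> \<theta> y"
  using hom_mult[OF theta_hom] .

lemma theta_closed [simp]: "x \<in> carrier W \<Longrightarrow> \<theta> x \<in> carrier W"
  using hom_in_carrier[OF theta_hom] .

lemma theta_gen [simp]: "s \<in> S \<Longrightarrow> \<theta> s \<in> S"
  using theta_S by blast

lemma theta_one [simp]: "\<theta> \<one> = \<one>"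
  using hom_one[OF theta_hom is_group is_group] .

lemma theta_inv: "x \<in> carrier W \<Longrightarrow> \<theta> (inv x) = inv (\<theta> x)"
  by (metis inv_closed inv_equality l_inv theta_closed theta_mult theta_one)

lemma theta_conj:
  "u \<in> carrier W \<Longrightarrow> x \<in> carrier W \<Longrightarrow> \<theta> (conj_by u x) = conj_by (\<theta> u) (\<theta> x)"
  by (simp add: conj_by_def theta_mult theta_inv)

lemma theta_wp: "ws \<in> lists S \<Longrightarrow> \<theta> (wp ws) = wp (map \<theta> ws)"
  by (induction ws) (auto simp: theta_mult)

lemma theta_len [simp]:
  assumes "x \<in> carrier W"
  shows "len (\<theta> x) = len x"
proof -
  have *: "len (\<theta> y) \<le> len y" if "y \<in> carrier W" for y
  proof -
    obtain ws where ws: "reduced ws" "wp ws = y" using ex_reduced[OF \<open>y \<in> carrier W\<close>] .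
    have l: "ws \<in> lists S" "map \<theta> ws \<in> lists S" using reduced_lists[OF ws(1)] by auto
    have "len (\<theta> y) \<le> length (map \<theta> ws)"
      using len_le[OF l(2)] theta_wp[OF l(1)] ws(2) by simp
    then show ?thesis using reduced_length[OF ws(1)] ws(2) by simp
  qed
  show ?thesis using *[of x] *[of "\<theta> x"] assms by simp
qed

abbreviation fixed :: "'a \<Rightarrow> bool" where
  "fixed x \<equiv> x \<in> carrier W \<and> \<theta> x = x"

text \<open>These are the orbits of finite type of the group \<open>{id, \<theta>}\<close>; an orbit
  is a singleton when \<open>\<theta> s = s\<close>.\<close>

definition foldable :: "'a set \<Rightarrow> bool" where
  "foldable J \<longleftrightarrow> (\<exists>s\<in>S. J = {s, \<theta> s}) \<and> finite (generate W J)"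

abbreviation longest :: "'a set \<Rightarrow> 'a" where
  "longest \<equiv> longest_elt W S"

lemma foldable_subset: "foldable J \<Longrightarrow> J \<subseteq> S"
  by (auto simp: foldable_def)

lemma foldable_eq: "foldable J \<Longrightarrow> s \<in> J \<Longrightarrow> J = {s, \<theta> s}"
  by (auto simp: foldable_def)

text \<open>For fixed \<open>x\<close>, the map \<open>\<theta>\<close> sends \<open>s x\<close> to
  \<open>\<theta> s\<close> times \<open>x\<close> and preserves length.\<close>

lemma foldable_descent:
  assumes "foldable J" "fixed x" "s \<in> J" "t \<in> J" "descent s x"
  shows "descent t x"
proof -
  have "s \<in> S" using foldable_subset assms by blast
  then have "len (\<theta> s \<otimes> x) = len (s \<otimes> x)"
    using theta_len[of "s \<otimes> x"] theta_mult[of s x] assms(2) by simp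
  then show ?thesis using assms foldable_eq[OF assms(1,3)] by auto
qed

lemma theta_generate:
  assumes "foldable J" "x \<in> generate W J"
  shows "\<theta> x \<in> generate W J"
proof -
  have J: "J \<subseteq> S" "\<theta> s \<in> J" if "s \<in> J" for s
    using foldable_subset[OF assms(1)] foldable_eq[OF assms(1) that] by auto
  obtain ws where ws: "ws \<in> lists J" "wp ws = x"
    using generate_words[OF foldable_subset[OF assms(1)]] assms(2) by auto
  then have "ws \<in> lists S" "map \<theta> ws \<in> lists J"
    using J foldable_subset[OF assms(1)] by auto
  then show ?thesis
    using generate_words[OF foldable_subset[OF assms(1)]] theta_wp ws(2) by auto
qed

text \<open>All descents of a fixed element of \<open>W\<^sub>J\<close> come together, so \<open>W\<^sub>J\<close> has just two fixed elements.\<close>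

lemma fixed_generate_eq_longest:
  assumes "foldable J" "x \<in> generate W J" "fixed x" "x \<noteq> \<one>"
  shows "longest J = x"
  using ex_descent_generate[OF foldable_subset[OF assms(1)] assms(2,4)]
    foldable_descent[OF assms(1,3)]
  by (intro longest_elt_eq[OF foldable_subset[OF assms(1)] assms(2)]) blast

lemma longest_generate: "foldable J \<Longrightarrow> longest J \<in> generate W J"
  and longest_descent: "foldable J \<Longrightarrow> s \<in> J \<Longrightarrow> descent s (longest J)"
  using longest_elt[of J] foldable_subset[of J] by (auto simp: foldable_def)

lemma longest_closed [simp]: "foldable J \<Longrightarrow> longest J \<in> carrier W"
  using generate_carrier foldable_subset longest_generate by blast

lemma longest_not_one: "foldable J \<Longrightarrow> longest J \<noteq> \<one>"
  using longest_descent[of J] unfolding foldable_def by force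

section \<open>Expanding words of orbits into words of generators\<close>

definition longest_word :: "'a set \<Rightarrow> 'a list" where
  "longest_word J = (SOME ws. ws \<in> lists J \<and> reduced ws \<and> wp ws = longest J)"

lemma longest_word:
  assumes "foldable J"
  shows "longest_word J \<in> lists J" "reduced (longest_word J)" "wp (longest_word J) = longest J"
proof -
  have "\<exists>ws. ws \<in> lists J \<and> reduced ws \<and> wp ws = longest J"
    using generate_reduced_word[OF foldable_subset[OF assms] longest_generate[OF assms]] by metis
  then have "longest_word J \<in> lists J \<and> reduced (longest_word J) \<and> wp (longest_word J) = longest J"
    unfolding longest_word_def by (rule someI_ex)
  then show "longest_word J \<in> lists J" "reduced (longest_word J)" "wp (longest_word J) = longest J"
    by blast+
qed

definition expand :: "'a set list \<Rightarrow> 'a list" where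
  "expand Ks = concat (map longest_word Ks)"

lemma expand_Nil [simp]: "expand [] = []"
  by (simp add: expand_def)

lemma expand_Cons [simp]: "expand (J # Ks) = longest_word J @ expand Ks"
  by (simp add: expand_def)

lemma longest_word_lists: "foldable J \<Longrightarrow> longest_word J \<in> lists S"
  using longest_word(2) reduced_lists by blast

lemma expand_lists: "Ks \<in> lists (Collect foldable) \<Longrightarrow> expand Ks \<in> lists S"
  using longest_word_lists by (induction Ks) auto

lemma wp_expand_Cons:
  "foldable J \<Longrightarrow> Ks \<in> lists (Collect foldable) \<Longrightarrow>
     wp (expand (J # Ks)) = longest J \<otimes> wp (expand Ks)"
  using expand_lists[of Ks] longest_word_lists[of J] longest_word(3)[of J] by (simp add: wp_append)

text \<open>Reflections of the expansion are grouped by blocks: undoing the conjugation by the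
  blocks in front leaves a reflection of the block of \<open>J\<close>, which lies in the subgroup
  generated by \<open>J\<close>.\<close>

lemma refls_expand:
  assumes "Ks \<in> lists (Collect foldable)" "t \<in> set (refls (expand Ks))"
  shows "\<exists>As J Bs. Ks = As @ J # Bs \<and> conj_by (inv (wp (expand As))) t \<in> generate W J"
  using assms
proof (induction Ks arbitrary: t rule: list.induct)
  case (Cons K Ks)
  then have K: "foldable K" "Ks \<in> lists (Collect foldable)" by auto
  have l: "longest_word K \<in> lists S" "expand Ks \<in> lists S"
    by (rule longest_word_lists[OF K(1)], rule expand_lists[OF K(2)])
  consider "t \<in> set (refls (longest_word K))"
    | r where "r \<in> set (refls (expand Ks))" "t = conj_by (longest K) r"
    using Cons.prems(2) l longest_word(3)[OF K(1)] by (auto simp: refls_append)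
  then show ?case
  proof cases
    case 1
    then have "t \<in> generate W K"
      using refls_generate[OF foldable_subset[OF K(1)] longest_word(1)[OF K(1)]] by blast
    moreover from this have "t \<in> carrier W" using generate_carrier foldable_subset[OF K(1)] by blast
    ultimately show ?thesis by (intro exI[of _ "[]"]) auto
  next
    case 2
    then obtain As J Bs where *: "Ks = As @ J # Bs" "conj_by (inv (wp (expand As))) r \<in> generate W J"
      using Cons.IH[OF K(2)] by blast
    have As: "As \<in> lists (Collect foldable)" using K(2) *(1) by auto
    have r: "r \<in> carrier W" using 2(1) refls_closed[OF l(2)] by blast
    have "conj_by (inv (wp (expand (K # As)))) t = conj_by (inv (wp (expand As))) r"
      unfolding wp_expand_Cons[OF K(1) As] 2(2)
      using K(1) expand_lists[OF As] r by (simp add: inv_mult_group conj_mult)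
    then show ?thesis using * by (intro exI[of _ "K # As"]) auto
  qed
qed simp

lemma len_longest_mult:
  assumes "foldable J" "x \<in> carrier W" "\<forall>s\<in>J. \<not> descent s x"
  shows "len (longest J \<otimes> x) = length (longest_word J) + len x"
  using len_mult_no_descent[OF foldable_subset[OF assms(1)] assms(2,3) longest_generate[OF assms(1)]]
    reduced_length[OF longest_word(2)[OF assms(1)]] longest_word(3)[OF assms(1)] by simp

text \<open>Both \<open>longest J\<close> and \<open>s\<close> times it lie in the parabolic
  subgroup, so lengths add with \<open>x\<close> for both, and the descent of
  \<open>longest J\<close> is inherited.\<close>

lemma descent_longest_mult:
  assumes "foldable J" "x \<in> carrier W" "\<forall>s\<in>J. \<not> descent s x" "s \<in> J"
  shows "descent s (longest J \<otimes> x)"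
proof -
  have J: "J \<subseteq> S" by (rule foldable_subset[OF assms(1)])
  note add = len_mult_no_descent[OF J assms(2,3)]
  have "len ((s \<otimes> longest J) \<otimes> x) = len (s \<otimes> longest J) + len x"
    by (rule add[OF generate_gen_mult[OF assms(4) longest_generate[OF assms(1)]]])
  then show ?thesis
    using add[OF longest_generate[OF assms(1)]] longest_descent[OF assms(1,4)] assms J
    by (simp add: m_assoc subsetD)
qed

end

section \<open>Subwords of mapped and concatenated lists\<close>

lemma subseq_map_right:
  "subseq xs (map f ys) \<Longrightarrow> \<exists>zs. subseq zs ys \<and> xs = map f zs"
proof (induction ys arbitrary: xs)
  case (Cons y ys)
  show ?case
  proof (cases "subseq xs (map f ys)")
    case True
    then show ?thesis using Cons.IH list_emb_Cons by metis
  next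
    case False
    then obtain us where "xs = f y # us" "subseq us (map f ys)"
      using Cons.prems by (cases xs) (auto split: if_splits)
    moreover from this obtain zs where "subseq zs ys" "us = map f zs" using Cons.IH by blast
    ultimately show ?thesis by (intro exI[of _ "y # zs"]) simp
  qed
qed (auto dest: list_emb_Nil2)

lemma subseq_concat_map: "subseq xs ys \<Longrightarrow> subseq (concat (map f xs)) (concat (map f ys))"
  by (induction rule: list_emb.induct) (auto intro: list_emb_append2 list_emb_append_mono)

section \<open>Comparison of \<open>Wt\<close> with the fixed points in \<open>W\<close>\<close>

locale folded = folding W S \<theta> + T: coxeter Wt St
  for W :: "('a, 'x) monoid_scheme" (structure) and S :: "'a set" and \<theta> :: "'a \<Rightarrow> 'a"
    and Wt :: "('b, 'y) monoid_scheme" and St :: "'b set" +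
  fixes st :: "'a set \<Rightarrow> 'b" and \<phi> :: "'b \<Rightarrow> 'a"
  assumes St_eq: "St = st ` Collect foldable"
    and phi_hom: "\<phi> \<in> hom Wt W"
    and phi_inj: "inj_on \<phi> (carrier Wt)"
    and phi_image: "\<phi> ` carrier Wt = {x. fixed x}"
    and phi_st: "foldable J \<Longrightarrow> \<phi> (st J) = longest J"
begin

lemma phi_fixed: "v \<in> carrier Wt \<Longrightarrow> fixed (\<phi> v)"
  using phi_image by blast

lemma phi_closed [simp]: "v \<in> carrier Wt \<Longrightarrow> \<phi> v \<in> carrier W"
  using phi_fixed by blast

lemma phi_mult: "u \<in> carrier Wt \<Longrightarrow> v \<in> carrier Wt \<Longrightarrow> \<phi> (u \<otimes>\<^bsub>Wt\<^esub> v) = \<phi> u \<otimes> \<phi> v"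
  using hom_mult[OF phi_hom] .

lemma phi_one: "\<phi> \<one>\<^bsub>Wt\<^esub> = \<one>"
  using hom_one[OF phi_hom T.is_group is_group] .

lemma phi_eqD: "u \<in> carrier Wt \<Longrightarrow> v \<in> carrier Wt \<Longrightarrow> \<phi> u = \<phi> v \<Longrightarrow> u = v"
  using phi_inj by (rule inj_onD)

lemma st_in [simp]: "foldable J \<Longrightarrow> st J \<in> St"
  using St_eq by blast

lemma st_closed [simp]: "foldable J \<Longrightarrow> st J \<in> carrier Wt"
  by (rule T.S_closed[OF st_in])

text \<open>The longest element is a value of \<open>\<phi>\<close>, and all these values are fixed
  points.\<close>

lemma longest_fixed: "foldable J \<Longrightarrow> fixed (longest J)"
  using phi_fixed[OF st_closed] phi_st by simp

lemma map_st_lists: "Ks \<in> lists (Collect foldable) \<Longrightarrow> map st Ks \<in> lists St"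
  by auto

lemma St_word:
  assumes "ws \<in> lists St"
  obtains Ks where "Ks \<in> lists (Collect foldable)" "ws = map st Ks"
  using assms unfolding St_eq lists_image by blast

lemma phi_wp: "Ks \<in> lists (Collect foldable) \<Longrightarrow> \<phi> (T.wp (map st Ks)) = wp (expand Ks)"
proof (induction Ks rule: list.induct)
  case (Cons J Ks)
  then have J: "foldable J" "Ks \<in> lists (Collect foldable)" by auto
  then show ?case
    using Cons.IH wp_expand_Cons[OF J] T.wp_closed[OF map_st_lists[OF J(2)]]
    by (simp add: phi_mult phi_st del: expand_Cons)
qed (simp add: phi_one)

text \<open>
  The reflection \<open>s\<close> occurs in some block of the expanded word, that is, conjugation by the (fixed)
  prefix before that block maps \<open>s\<close> into \<open>W\<^sub>K\<close>. By symmetry it maps all of \<open>W\<^sub>J\<close> into \<open>W\<^sub>K\<close>, hence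
  \<open>w\<^sub>0(J)\<close> to the only nontrivial fixed element \<open>w\<^sub>0(K)\<close>. Injectivity of \<open>\<phi>\<close> turns this into an
  exchange in \<open>Wt\<close>.
\<close>

lemma folded_descent:
  assumes v: "v \<in> carrier Wt" and J: "foldable J" "s \<in> J" and d: "descent s (\<phi> v)"
  shows "T.descent (st J) v"
proof -
  obtain ws where ws: "T.reduced ws" "T.wp ws = v" using T.ex_reduced[OF v] .
  obtain Ks where Ks: "Ks \<in> lists (Collect foldable)" "ws = map st Ks"
    using St_word[OF T.reduced_lists[OF ws(1)]] .
  have JS: "J \<subseteq> S" by (rule foldable_subset[OF J(1)])
  have s: "s \<in> S" using J JS by blast
  have "\<phi> v = wp (expand Ks)" using phi_wp[OF Ks(1)] ws Ks by simp
  then have "s \<in> set (refls (expand Ks))"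
    using d s by (intro strong_exchange[OF expand_lists[OF Ks(1)]]) auto
  then obtain As K Bs where K: "Ks = As @ K # Bs" "conj_by (inv (wp (expand As))) s \<in> generate W K"
    using refls_expand[OF Ks(1)] by blast
  have f: "As \<in> lists (Collect foldable)" "foldable K" "Bs \<in> lists (Collect foldable)"
    using Ks(1) K(1) by auto
  have KS: "K \<subseteq> S" by (rule foldable_subset[OF f(2)])
  define p q where "p = T.wp (map st As)" and "q = T.wp (map st Bs)"
  have pq: "p \<in> carrier Wt" "q \<in> carrier Wt"
    unfolding p_def q_def using T.wp_closed map_st_lists f by blast+
  have p_fixed: "fixed (\<phi> p)" by (rule phi_fixed[OF pq(1)])
  let ?c = "conj_by (inv (\<phi> p))"
  have ip: "inv (\<phi> p) \<in> carrier W" "\<theta> (inv (\<phi> p)) = inv (\<phi> p)"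
    using p_fixed by (simp_all add: theta_inv)
  have cs: "?c s \<in> generate W K" using K(2) phi_wp[OF f(1)] p_def by simp
  have "?c (\<theta> s) = \<theta> (?c s)" using ip s by (simp add: theta_conj)
  then have "?c (\<theta> s) \<in> generate W K" using theta_generate[OF f(2) cs] by simp
  then have cJ: "?c r \<in> generate W K" if "r \<in> J" for r
    using that cs foldable_eq[OF J] by auto
  have "?c (wp rs) \<in> generate W K" if "rs \<in> lists J" for rs
    using that
  proof (induction rs rule: list.induct)
    case Nil
    then show ?case using ip p_fixed generate.one by (simp add: conj_by_def)
  next
    case (Cons r rs)
    then have "r \<in> S" "rs \<in> lists S" using JS by auto
    then show ?case using Cons cJ ip by (auto simp: conj_hom intro!: generate.eng)
  qed
  then have c0: "?c (longest J) \<in> generate W K" using longest_word[OF J(1)] by metis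
  have "fixed (?c (longest J))"
    using ip longest_fixed[OF J(1)] by (simp add: theta_conj)
  moreover have "?c (longest J) \<noteq> \<one>"
  proof
    assume "?c (longest J) = \<one>"
    then have "longest J = conj_by (\<phi> p) \<one>"
      using conj_inv_cancel(2)[of "\<phi> p" "longest J"] p_fixed J(1) by simp
    then show False using longest_not_one[OF J(1)] p_fixed by (simp add: conj_by_def)
  qed
  ultimately have "longest K = ?c (longest J)"
    by (intro fixed_generate_eq_longest[OF f(2) c0])
  then have "longest J = conj_by (\<phi> p) (longest K)" using p_fixed J(1) by simp
  then have "longest J \<otimes> \<phi> p = \<phi> p \<otimes> longest K"
    using conj_conj_mult p_fixed f(2) by simp
  then have "\<phi> (st J \<otimes>\<^bsub>Wt\<^esub> p) = \<phi> (p \<otimes>\<^bsub>Wt\<^esub> st K)"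
    using J(1) f(2) pq by (simp add: phi_mult phi_st)
  then have comm: "st J \<otimes>\<^bsub>Wt\<^esub> p = p \<otimes>\<^bsub>Wt\<^esub> st K"
    using J(1) f(2) pq by (intro phi_eqD) auto
  have v_eq: "v = p \<otimes>\<^bsub>Wt\<^esub> (st K \<otimes>\<^bsub>Wt\<^esub> q)"
    using ws(2) Ks(2) K(1) T.wp_append[OF map_st_lists[OF f(1)], of "map st (K # Bs)"] f
    by (auto simp: p_def q_def)
  \<comment> \<open>Moved past the prefix \<open>p\<close>, the factor \<open>st J\<close> becomes
    \<open>st K\<close> and cancels the letter \<open>st K\<close> of the reduced word, which leaves
    a word with one letter less.\<close>
  have "st J \<otimes>\<^bsub>Wt\<^esub> v = (st J \<otimes>\<^bsub>Wt\<^esub> p) \<otimes>\<^bsub>Wt\<^esub> (st K \<otimes>\<^bsub>Wt\<^esub> q)"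
    unfolding v_eq using J(1) f(2) pq by (simp add: T.m_assoc)
  also have "\<dots> = p \<otimes>\<^bsub>Wt\<^esub> q"
    unfolding comm using f(2) pq by (simp add: T.m_assoc)
  also have "\<dots> = T.wp (map st (As @ Bs))"
    using T.wp_append[OF map_st_lists[OF f(1)] map_st_lists[OF f(3)]] by (simp add: p_def q_def)
  finally have "T.len (st J \<otimes>\<^bsub>Wt\<^esub> v) \<le> length (As @ Bs)"
    using T.len_le[OF map_st_lists, of "As @ Bs"] f by auto
  then show ?thesis
    using T.reduced_length[OF ws(1)] ws(2) Ks(2) K(1) by simp
qed

text \<open>If \<open>s\<close> is not a descent of \<open>\<phi> v\<close>, no element of
  \<open>J\<close> is. Then \<open>s\<close> is a descent of \<open>longest J\<close> times
  \<open>\<phi> v\<close>, so \<open>folded_descent\<close> makes \<open>st J\<close> a descent of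
  \<open>st J\<close> times \<open>v\<close>, and hence not of \<open>v\<close>.\<close>

lemma folded_descent_iff:
  assumes v: "v \<in> carrier Wt" and J: "foldable J" "s \<in> J"
  shows "T.descent (st J) v \<longleftrightarrow> descent s (\<phi> v)"
proof
  assume d: "T.descent (st J) v"
  show "descent s (\<phi> v)"
  proof (rule ccontr)
    assume "\<not> descent s (\<phi> v)"
    then have "\<forall>r\<in>J. \<not> descent r (\<phi> v)"
      using foldable_descent[OF J(1) phi_fixed[OF v] _ J(2)] by blast
    then have "descent s (\<phi> (st J \<otimes>\<^bsub>Wt\<^esub> v))"
      using descent_longest_mult[OF J(1) _ _ J(2)] J(1) v by (simp add: phi_mult phi_st)
    then have "T.descent (st J) (st J \<otimes>\<^bsub>Wt\<^esub> v)"
      using v J by (intro folded_descent) auto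
    then show False using d J(1) v by simp
  qed
qed (rule folded_descent[OF assms])

lemma phi_st_mult:
  assumes "v \<in> carrier Wt" "foldable J" "\<not> T.descent (st J) v"
  shows "\<phi> (st J \<otimes>\<^bsub>Wt\<^esub> v) = wp (longest_word J) \<otimes> \<phi> v"
    and "len (wp (longest_word J) \<otimes> \<phi> v) = length (longest_word J) + len (\<phi> v)"
proof -
  show "\<phi> (st J \<otimes>\<^bsub>Wt\<^esub> v) = wp (longest_word J) \<otimes> \<phi> v"
    using assms longest_word(3)[OF assms(2)] by (simp add: phi_mult phi_st)
  have "\<forall>s\<in>J. \<not> descent s (\<phi> v)" using folded_descent_iff assms by blast
  then show "len (wp (longest_word J) \<otimes> \<phi> v) = length (longest_word J) + len (\<phi> v)"
    using len_longest_mult[OF assms(2)] assms(1) longest_word(3)[OF assms(2)] by simp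
qed

text \<open>Each letter prepended to a reduced word of \<open>Wt\<close> is a non-descent, so by
  \<open>phi_st_mult\<close> its block adds its full length.\<close>

lemma reduced_expand:
  "Ks \<in> lists (Collect foldable) \<Longrightarrow> T.reduced (map st Ks) \<Longrightarrow> reduced (expand Ks)"
proof (induction Ks rule: list.induct)
  case Nil
  then show ?case by (simp add: reduced_def)
next
  case (Cons J Ks)
  then have J: "foldable J" "Ks \<in> lists (Collect foldable)"
    and r: "T.reduced (map st Ks)" "\<not> T.descent (st J) (T.wp (map st Ks))"
    by (auto simp: T.reduced_Cons_iff)
  have l: "T.wp (map st Ks) \<in> carrier Wt" by (rule T.wp_closed[OF map_st_lists[OF J(2)]])
  have IH: "reduced (expand Ks)" using Cons.IH J(2) r(1) by blast
  have "wp (expand (J # Ks)) = wp (longest_word J) \<otimes> \<phi> (T.wp (map st Ks))"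
    using wp_expand_Cons[OF J] phi_wp[OF J(2)] longest_word(3)[OF J(1)] by simp
  then have "len (wp (expand (J # Ks))) = length (expand (J # Ks))"
    using phi_st_mult(2)[OF l J(1) r(2)] phi_wp[OF J(2)] reduced_length[OF IH] by simp
  then show ?case using expand_lists[of "J # Ks"] J unfolding reduced_def by auto
qed

text \<open>A subword for \<open>u\<close> of a reduced word for \<open>v\<close> lifts to a subword
  \<open>Ls\<close> of the orbit word \<open>Ks\<close>, and expansion keeps the subword relation
  while \<open>expand Ks\<close> is reduced.\<close>

lemma bruhat_phi:
  assumes "T.bruhat u v" "v \<in> carrier Wt"
  shows "bruhat (\<phi> u) (\<phi> v)"
proof -
  obtain ws where ws: "T.reduced ws" "T.wp ws = v" using T.ex_reduced[OF assms(2)] .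
  obtain Ks where Ks: "Ks \<in> lists (Collect foldable)" "ws = map st Ks"
    using St_word[OF T.reduced_lists[OF ws(1)]] .
  obtain us where us: "subseq us ws" "T.wp us = u"
    using T.bruhat_subword[of u ws] assms(1) ws T.reduced_lists[OF ws(1)] by blast
  obtain Ls where Ls: "subseq Ls Ks" "us = map st Ls" using subseq_map_right us(1) Ks(2) by metis
  have "bruhat (wp (expand Ls)) (wp (expand Ks))"
    using reduced_expand[OF Ks(1)] ws(1) Ks(2) subseq_concat_map[OF Ls(1)]
    by (intro subword_bruhat) (auto simp: expand_def)
  then show ?thesis
    using phi_wp[OF Ks(1)] phi_wp[OF subseq_lists[OF Ls(1) Ks(1)]] us ws Ks Ls by simp
qed

lemma bruhat_phiD:
  assumes "Ks \<in> lists (Collect foldable)" "T.reduced (map st Ks)" "u \<in> carrier Wt"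
    and "bruhat (\<phi> u) (\<phi> (T.wp (map st Ks)))"
  shows "T.bruhat u (T.wp (map st Ks))"
  using assms
proof (induction Ks arbitrary: u rule: list.induct)
  case Nil
  \<comment> \<open>Nothing has smaller length than the identity, so only the identity lies below
    it.\<close>
  then have "\<phi> u = \<one>" using bruhat_len[of "\<phi> u" \<one>] by (simp add: phi_one)
  then have "u = \<one>\<^bsub>Wt\<^esub>" using Nil.prems(3) phi_one by (intro phi_eqD) auto
  then show ?case by simp
next
  case (Cons J Ks)
  let ?v = "T.wp (map st Ks)"
  have J: "foldable J" "Ks \<in> lists (Collect foldable)"
    and r: "T.reduced (map st Ks)" "\<not> T.descent (st J) ?v"
    using Cons.prems by (auto simp: T.reduced_Cons_iff)
  have v: "?v \<in> carrier Wt" by (rule T.wp_closed[OF map_st_lists[OF J(2)]])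
  have up: "T.bruhat_step ?v (st J \<otimes>\<^bsub>Wt\<^esub> ?v)"
    by (rule T.bruhat_step_gen[OF st_in[OF J(1)] v r(2)])
  note phi_v = phi_st_mult[OF v J(1) r(2)]
  have le: "bruhat (\<phi> u) (wp (longest_word J) \<otimes> \<phi> ?v)" using Cons.prems(4) phi_v(1) by simp
  have l: "longest_word J \<in> lists S" by (rule longest_word_lists[OF J(1)])
  show ?case
  proof (cases "T.descent (st J) u")
    case True
    \<comment> \<open>Removing \<open>st J\<close> from \<open>u\<close> corresponds to removing the
      whole block from \<open>\<phi> u\<close>, so both sides share this block as a length-additive
      prefix.\<close>
    define u' where "u' = st J \<otimes>\<^bsub>Wt\<^esub> u"
    have u': "u' \<in> carrier Wt" "st J \<otimes>\<^bsub>Wt\<^esub> u' = u" "\<not> T.descent (st J) u'"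
      using Cons.prems(3) J(1) True by (simp_all add: u'_def)
    note phi_u = phi_st_mult[OF u'(1) J(1) u'(3)]
    have "bruhat (wp (longest_word J) \<otimes> \<phi> u') (wp (longest_word J) \<otimes> \<phi> ?v)"
      using le phi_u(1) u'(2) by simp
    then have "bruhat (\<phi> u') (\<phi> ?v)"
      by (rule bruhat_cancel_common_prefix
          [OF phi_closed[OF u'(1)] phi_closed[OF v] l phi_u(2) phi_v(2)])
    then have "T.bruhat u' ?v" using Cons.IH[OF J(2) r(1) u'(1)] by blast
    then have "T.bruhat u ?v \<or> T.bruhat u (st J \<otimes>\<^bsub>Wt\<^esub> ?v)"
      using T.bruhat_gen_mult[of u' ?v "st J"] u'(2) J(1) by simp
    then show ?thesis using up by auto
  next
    case False
    \<comment> \<open>No letter of the block is a descent of \<open>\<phi> u\<close>, so the block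
      can be cancelled on the right-hand side only.\<close>
    have "\<forall>s\<in>set (longest_word J). \<not> descent s (\<phi> u)"
      using folded_descent_iff[OF Cons.prems(3) J(1)] False longest_word(1)[OF J(1)] by auto
    then have "bruhat (\<phi> u) (\<phi> ?v)"
      using bruhat_cancel_prefix[OF _ l phi_v(2) le] v by simp
    then have "T.bruhat u ?v" using Cons.IH[OF J(2) r(1) Cons.prems(3)] by blast
    then show ?thesis using up by auto
  qed
qed

lemma bruhat_phi_iff:
  assumes "u \<in> carrier Wt" "v \<in> carrier Wt"
  shows "bruhat (\<phi> u) (\<phi> v) \<longleftrightarrow> T.bruhat u v"
proof
  obtain ws where ws: "T.reduced ws" "T.wp ws = v" using T.ex_reduced[OF assms(2)] .
  obtain Ks where Ks: "Ks \<in> lists (Collect foldable)" "ws = map st Ks"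
    using St_word[OF T.reduced_lists[OF ws(1)]] .
  show "T.bruhat u v" if "bruhat (\<phi> u) (\<phi> v)"
    using bruhat_phiD[OF Ks(1) _ assms(1)] that ws Ks(2) by simp
qed (rule bruhat_phi[OF _ assms(2)])

end

theorem theorem5p5:
  fixes W :: "('a, 'x) monoid_scheme" and S :: "'a set"
    and \<theta> :: "'a \<Rightarrow> 'a" and G :: "('a \<Rightarrow> 'a) set"
    and Wt :: "('b, 'y) monoid_scheme" and St :: "'b set"
    and st :: "'a set \<Rightarrow> 'b" and \<phi> :: "'b \<Rightarrow> 'a"
  assumes "coxeter_system W S" and "finite S"
    and "\<theta> \<in> iso W W" and "\<forall>w\<in>carrier W. \<theta> (\<theta> w) = w" and "\<theta> ` S = S"
    and "G = {id, \<theta>}"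
    and "coxeter_system Wt St"
    and "St = {st J | J. J \<in> finite_type_orbits W S G}"
    and "\<phi> \<in> hom Wt W" and "inj_on \<phi> (carrier Wt)"
    and "\<phi> ` carrier Wt = fixed_points W G"
    and "\<forall>J\<in>finite_type_orbits W S G. \<phi> (st J) = longest_elt W S J"
  shows "order_isomorphic (fixed_points W G) (bruhat_le W S) (carrier Wt) (bruhat_le Wt St)"
proof -
  interpret W: folding W S \<theta>
    using assms(1,3-5)
    by (auto simp: folding_def folding_axioms_def coxeter_def coxeter_axioms_def coxeter_system_def iso_def)
  \<comment> \<open>The orbit of \<open>s\<close> under \<open>{id, \<theta>}\<close> is
    \<open>{s, \<theta> s}\<close>, which is the shape used in \<open>foldable\<close>.\<close>
  have "finite_type_orbits W S G = Collect W.foldable"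
  proof -
    have "{g s |g. g \<in> G} = {s, \<theta> s}" for s
      unfolding Setcompr_eq_image assms(6) by simp
    then show ?thesis
      by (auto simp: finite_type_orbits_def orbits_on_def W.foldable_def)
  qed
  moreover have fixed: "fixed_points W G = {x. W.fixed x}"
    using assms(6) by (auto simp: fixed_points_def)
  moreover have "coxeter Wt St"
    using assms(7) by (simp add: coxeter_def coxeter_axioms_def coxeter_system_def)
  ultimately interpret folded W S \<theta> Wt St st \<phi>
    using W.folding_axioms assms(8-12)
    by (auto simp: folded_def folded_axioms_def)
  \<comment> \<open>The isomorphism runs from the fixed points to \<open>Wt\<close>, so it is the
    inverse of \<open>\<phi>\<close> on its image.\<close>
  let ?f = "inv_into (carrier Wt) \<phi>"
  have f: "?f x \<in> carrier Wt" "\<phi> (?f x) = x" if "x \<in> fixed_points W G" for x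
    using that assms(11) inv_into_into f_inv_into_f by metis+
  have "bij_betw ?f (fixed_points W G) (carrier Wt)"
    using assms(10,11) by (intro bij_betw_inv_into) (simp add: bij_betw_def)
  moreover have "bruhat_le W S x y \<longleftrightarrow> bruhat_le Wt St (?f x) (?f y)"
    if "x \<in> fixed_points W G" "y \<in> fixed_points W G" for x y
    using that f[OF that(1)] f[OF that(2)] bruhat_phi_iff[of "?f x" "?f y"]
      W.bruhat_le_iff[of y x] T.bruhat_le_iff[of "?f y" "?f x"] fixed by simp
  ultimately show ?thesis unfolding order_isomorphic_def by blast
qed

end
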